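(* The Banach space $L_1(\mathbb{R})$, equipped with the Hartley-Fourier generalized convolution $\underset{H_1,F}{*}$ as multiplication, i.e. $\big(L_1(\mathbb{R}),\underset{H_1,F}{*}\big)$, is a non-commutative normed ring and has no unit element.
   Context: The Hartley-Fourier generalized convolution of $f$ and $g$ is $$\big(f\underset{H_1,F}{*}g\big)(x):=\frac{1}{2\sqrt{2\pi}}\int_{\mathbb{R}} g(y)\,[f(x+y)+f(x-y)+i\,f(-x-y)-i\,f(-x+y)]\,dy,\quad x\in\mathbb{R}.$$ Definition: a vector space $V$ with a ring structure and a vector norm is called a normed ring if $\|vw\|\le\|v\|\,\|w\|$ for all $v,w\in V$; if $V$ has a multiplicative unit element $\mathcal{U}$, it is also required that $\|\mathcal{U}\|=1$. A unit element of $\big(L_1(\mathbb{R}),\underset{H_1,F}{*}\big)$ would be $\mathcal{U}\in L_1(\mathbb{R})$ with $\mathcal{U}\underset{H_1,F}{*}f=f\underset{H_1,F}{*}\mathcal{U}=f$ for all $f\in L_1(\mathbb{R})$.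
   Formalization: "Ring" is taken here without associativity, because the Hartley-Fourier convolution is not associative: for f even and g, h odd, f*(g*h) = i((f*g)*h), which is nonzero for f = exp(-x^2), g = h = x exp(-x^2). *)

theory Defs
  imports "HOL-Analysis.Analysis"
begin

section \<open>The Banach space of complex-valued integrable functions on the real line\<close>

text \<open>
  Elements are classes of Lebesgue-integrable functions modulo equality almost everywhere.
  Using \<^const>\<open>lborel\<close> only means that the representatives are Borel measurable; every class of
  Lebesgue measurable functions contains such a representative.
\<close>

definition L1_rel :: "(real \<Rightarrow> complex) \<Rightarrow> (real \<Rightarrow> complex) \<Rightarrow> bool" where
  "L1_rel f g \<longleftrightarrow> integrable lborel f \<and> integrable lborel g \<and> (AE x in lborel. f x = g x)"

lemma L1_relI:
  "integrable lborel f \<Longrightarrow> integrable lborel g \<Longrightarrow> (AE x in lborel. f x = g x) \<Longrightarrow> L1_rel f g"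
  by (simp add: L1_rel_def)

lemma L1_rel_part_equivp: "part_equivp L1_rel"
proof (rule part_equivpI)
  show "\<exists>f. L1_rel f f"
    by (rule exI[of _ "\<lambda>_. 0"]) (simp add: L1_rel_def)
  show "symp L1_rel"
    by (auto simp: symp_def L1_rel_def)
  show "transp L1_rel"
    unfolding transp_def L1_rel_def by (auto elim: eventually_elim2)
qed

quotient_type L1 = "real \<Rightarrow> complex" / partial: L1_rel
  by (rule L1_rel_part_equivp)

instantiation L1 :: real_normed_vector
begin

lift_definition zero_L1 :: L1 is "\<lambda>_. 0"
  by (simp add: L1_rel_def)

lift_definition plus_L1 :: "L1 \<Rightarrow> L1 \<Rightarrow> L1" is "\<lambda>f g x. f x + g x"
  by (auto simp: L1_rel_def)

lift_definition minus_L1 :: "L1 \<Rightarrow> L1 \<Rightarrow> L1" is "\<lambda>f g x. f x - g x"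
  by (auto simp: L1_rel_def)

lift_definition uminus_L1 :: "L1 \<Rightarrow> L1" is "\<lambda>f x. - f x"
  by (auto simp: L1_rel_def)

lift_definition scaleR_L1 :: "real \<Rightarrow> L1 \<Rightarrow> L1" is "\<lambda>r f x. r *\<^sub>R f x"
  by (auto simp: L1_rel_def)

lift_definition norm_L1 :: "L1 \<Rightarrow> real" is "\<lambda>f. \<integral>x. norm (f x) \<partial>lborel"
  by (rule integral_cong_AE) (auto simp: L1_rel_def)

definition sgn_L1 :: "L1 \<Rightarrow> L1" where "sgn_L1 f = inverse (norm f) *\<^sub>R f"

definition dist_L1 :: "L1 \<Rightarrow> L1 \<Rightarrow> real" where "dist_L1 f g = norm (f - g)"

definition uniformity_L1 :: "(L1 \<times> L1) filter" where
  "uniformity_L1 = (INF e\<in>{0 <..}. principal {(f, g). dist f g < e})"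

definition open_L1 :: "L1 set \<Rightarrow> bool" where
  "open_L1 S = (\<forall>f\<in>S. \<forall>\<^sub>F (f', g) in uniformity. f' = f \<longrightarrow> g \<in> S)"

instance
proof
  fix f g h :: L1 and a b :: real
  show "f + g + h = f + (g + h)" by transfer (auto intro!: L1_relI simp: L1_rel_def add.assoc)
  show "f + g = g + f" by transfer (auto intro!: L1_relI simp: L1_rel_def add.commute)
  show "0 + f = f" by transfer (auto intro!: L1_relI simp: L1_rel_def)
  show "- f + f = 0" by transfer (auto intro!: L1_relI simp: L1_rel_def)
  show "f - g = f + - g" by transfer (auto intro!: L1_relI simp: L1_rel_def)
  show "a *\<^sub>R (f + g) = a *\<^sub>R f + a *\<^sub>R g"
    by transfer (auto intro!: L1_relI simp: L1_rel_def scaleR_right_distrib)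
  show "(a + b) *\<^sub>R f = a *\<^sub>R f + b *\<^sub>R f"
    by transfer (auto intro!: L1_relI simp: L1_rel_def scaleR_left_distrib)
  show "a *\<^sub>R b *\<^sub>R f = (a * b) *\<^sub>R f"
    by transfer (auto intro!: L1_relI simp: L1_rel_def)
  show "1 *\<^sub>R f = f" by transfer (auto intro!: L1_relI simp: L1_rel_def)
  show "(norm f = 0) = (f = 0)"
    by transfer (auto simp: L1_rel_def integral_nonneg_eq_0_iff_AE)
  show "norm (f + g) \<le> norm f + norm g"
  proof (transfer, goal_cases)
    case (1 f g)
    then have i: "integrable lborel f" "integrable lborel g"
      by (auto simp: L1_rel_def)
    have "(\<integral>x. norm (f x + g x) \<partial>lborel) \<le> (\<integral>x. norm (f x) + norm (g x) \<partial>lborel)"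
      using i by (intro integral_mono) (auto intro: norm_triangle_ineq)
    then show ?case using i by simp
  qed
  show "norm (a *\<^sub>R f) = \<bar>a\<bar> * norm f"
    by transfer (auto simp: L1_rel_def)
qed (rule sgn_L1_def dist_L1_def uniformity_L1_def open_L1_def)+

end

lift_definition scale_L1 :: "complex \<Rightarrow> L1 \<Rightarrow> L1" is "\<lambda>c f x. c * f x"
  by (auto simp: L1_rel_def)

lemma L1_class_sum:
  fixes n :: nat
  assumes "\<And>i. L1_rel (u i) (u i)"
  shows "(\<Sum>i<n. abs_L1 (u i)) = abs_L1 (\<lambda>x. \<Sum>i<n. u i x) \<and>
    L1_rel (\<lambda>x. \<Sum>i<n. u i x) (\<lambda>x. \<Sum>i<n. u i x)"
proof (induction n)
  case 0
  then show ?case by (simp add: zero_L1_def L1_rel_def)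
next
  case (Suc n)
  then show ?case
    using assms[of n] by (auto simp: plus_L1.abs_eq L1_rel_def)
qed

lemma L1_suminf:
  fixes F :: "nat \<Rightarrow> L1"
  assumes sm: "summable (\<lambda>i. norm (F i))"
  shows "summable F"
proof -
  define u where "u i = rep_L1 (F i)" for i
  have u: "L1_rel (u i) (u i)" and F: "F i = abs_L1 (u i)" for i
    using Quotient_L1 unfolding u_def by (auto simp: Quotient_rep_reflp Quotient_abs_rep)
  have iu[measurable]: "integrable lborel (u i)" for i
    using u by (simp add: L1_rel_def)
  have nF: "norm (F i) = (\<integral>x. norm (u i x) \<partial>lborel)" for i
    by (simp add: F norm_L1.abs_eq u)
  have "(\<integral>\<^sup>+x. (\<Sum>i. ennreal (norm (u i x))) \<partial>lborel) = (\<Sum>i. \<integral>\<^sup>+x. norm (u i x) \<partial>lborel)"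
    by (rule nn_integral_suminf) auto
  also have "\<dots> = (\<Sum>i. ennreal (norm (F i)))"
    unfolding nF by (intro arg_cong[where f=suminf] ext nn_integral_eq_integral) (auto intro: iu)
  also have "\<dots> \<noteq> top"
    using sm by (intro ennreal_suminf_neq_top) auto
  finally have "AE x in lborel. (\<Sum>i. ennreal (norm (u i x))) \<noteq> \<infinity>"
    by (intro nn_integral_PInf_AE) auto
  then have ae: "AE x in lborel. summable (\<lambda>i. norm (u i x))"
    by eventually_elim (auto intro: summable_suminf_not_top)
  define s where "s x = (\<Sum>i. u i x)" for x
  have tail: "integrable lborel (\<lambda>x. \<Sum>i. u (i + n) x)"
      "norm (\<integral>x. norm (\<Sum>i. u (i + n) x) \<partial>lborel) \<le> (\<Sum>i. norm (F (i + n)))" for n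
  proof -
    have a: "AE x in lborel. summable (\<lambda>i. norm (u (i + n) x))"
      using ae by eventually_elim (rule summable_ignore_initial_segment)
    have b: "summable (\<lambda>i. \<integral>x. norm (u (i + n) x) \<partial>lborel)"
      using summable_ignore_initial_segment[OF sm, of n] by (simp add: nF)
    show 1: "integrable lborel (\<lambda>x. \<Sum>i. u (i + n) x)"
      by (rule integrable_suminf[OF iu a b])
    have a': "AE x in lborel. summable (\<lambda>i. norm (norm (u (i + n) x)))"
      using a by simp
    have b': "summable (\<lambda>i. \<integral>x. norm (norm (u (i + n) x)) \<partial>lborel)"
      using b by simp
    have 2: "integrable lborel (\<lambda>x. \<Sum>i. norm (u (i + n) x))"
      by (rule integrable_suminf[OF integrable_norm[OF iu] a' b'])
    have "(\<integral>x. norm (\<Sum>i. u (i + n) x) \<partial>lborel) \<le> (\<integral>x. (\<Sum>i. norm (u (i + n) x)) \<partial>lborel)"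
      using 1 2 a by (intro integral_mono_AE) (auto intro: summable_norm)
    also have "\<dots> = (\<Sum>i. norm (F (i + n)))"
      unfolding nF by (rule integral_suminf[OF integrable_norm[OF iu] a' b'])
    finally show "norm (\<integral>x. norm (\<Sum>i. u (i + n) x) \<partial>lborel) \<le> (\<Sum>i. norm (F (i + n)))"
      by simp
  qed
  have s: "L1_rel s s"
    using tail(1)[of 0] by (simp add: L1_rel_def s_def[abs_def])
  have bound: "norm ((\<Sum>i<n. F i) - abs_L1 s) \<le> (\<Sum>i. norm (F (i + n)))" for n
  proof -
    have p: "L1_rel (\<lambda>x. (\<Sum>i<n. u i x) - s x) (\<lambda>x. (\<Sum>i<n. u i x) - s x)"
      using L1_class_sum[of u n, OF u] s by (auto simp: L1_rel_def)
    have "norm ((\<Sum>i<n. F i) - abs_L1 s) = (\<integral>x. norm ((\<Sum>i<n. u i x) - s x) \<partial>lborel)"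
      using L1_class_sum[of u n, OF u] s p by (simp add: F minus_L1.abs_eq norm_L1.abs_eq)
    also have "\<dots> = (\<integral>x. norm (\<Sum>i. u (i + n) x) \<partial>lborel)"
    proof (rule integral_cong_AE)
      show "AE x in lborel. norm ((\<Sum>i<n. u i x) - s x) = norm (\<Sum>i. u (i + n) x)"
        using ae
      proof eventually_elim
        case (elim x)
        then show ?case
          using suminf_split_initial_segment[OF summable_norm_cancel[OF elim], of n]
          by (simp add: s_def norm_minus_commute)
      qed
    qed (use p tail(1)[of n] in \<open>auto simp: L1_rel_def\<close>)
    finally show ?thesis using tail(2)[of n] by simp
  qed
  have "(\<lambda>n. \<Sum>i. norm (F (i + n))) \<longlonglongrightarrow> 0"
    by (rule suminf_exist_split2[OF sm])
  then have "(\<lambda>n. (\<Sum>i<n. F i) - abs_L1 s) \<longlonglongrightarrow> 0"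
    by (rule Lim_null_comparison[OF always_eventually[OF allI[OF bound]]])
  then have "F sums abs_L1 s"
    unfolding sums_def by (rule LIM_zero_cancel)
  then show ?thesis by (rule sums_summable)
qed

instance L1 :: banach
proof
  fix X :: "nat \<Rightarrow> L1"
  assume X: "Cauchy X"
  have "\<exists>r. strict_mono r \<and> (\<forall>k. norm (X (r (Suc k)) - X (r k)) < (1/2) ^ k)"
  proof -
    have "\<forall>k. \<exists>N. \<forall>m\<ge>N. \<forall>n\<ge>N. norm (X m - X n) < (1/2) ^ k"
      using X by (auto simp: Cauchy_iff)
    then obtain N where N: "\<And>k m n. N k \<le> m \<Longrightarrow> N k \<le> n \<Longrightarrow> norm (X m - X n) < (1/2) ^ k"
      by metis
    define r where "r k = (\<Sum>i\<le>k. N i + 1)" for k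
    have ge: "N k \<le> r k" for k
      unfolding r_def by (cases k) auto
    have st: "strict_mono r"
      by (rule strict_monoI_Suc) (simp add: r_def)
    have "norm (X (r (Suc k)) - X (r k)) < (1/2) ^ k" for k
      using ge[of k] strict_mono_less[OF st, of k "Suc k"] by (intro N) auto
    with st show ?thesis by blast
  qed
  then obtain r where r: "strict_mono r" "\<And>k. norm (X (r (Suc k)) - X (r k)) < (1/2) ^ k"
    by blast
  have "summable (\<lambda>k. norm (X (r (Suc k)) - X (r k)))"
    by (rule summable_comparison_test'[of "\<lambda>k. (1/2::real) ^ k" 0])
      (auto simp: summable_geometric intro: less_imp_le r(2))
  then have "summable (\<lambda>k. X (r (Suc k)) - X (r k))"
    by (rule L1_suminf)
  then have "convergent (\<lambda>n. \<Sum>k<n. X (r (Suc k)) - X (r k))"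
    by (simp add: summable_iff_convergent)
  then have "convergent (\<lambda>n. X (r n) - X (r 0))"
    by (simp add: sum_lessThan_telescope[of "\<lambda>k. X (r k)"])
  then have "convergent (\<lambda>n. X (r n) - X (r 0) + X (r 0))"
    by (intro convergent_add convergent_const)
  then obtain L where L: "(X \<circ> r) \<longlonglongrightarrow> L"
    by (auto simp: convergent_def o_def)
  have "X \<longlonglongrightarrow> L"
  proof (rule LIMSEQ_I)
    fix e :: real
    assume e: "0 < e"
    obtain N where N: "\<And>m n. N \<le> m \<Longrightarrow> N \<le> n \<Longrightarrow> norm (X m - X n) < e / 2"
      using CauchyD[OF X, of "e / 2"] e by auto
    obtain M where M: "\<And>n. M \<le> n \<Longrightarrow> norm (X (r n) - L) < e / 2"
      using LIMSEQ_D[OF L, of "e / 2"] e by auto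
    have "norm (X n - L) < e" if "N \<le> n" for n
    proof -
      let ?k = "max N M"
      have "norm (X n - X (r ?k)) < e / 2"
        using that seq_suble[OF r(1), of ?k] by (intro N) auto
      moreover have "norm (X (r ?k) - L) < e / 2"
        by (rule M) simp
      ultimately show ?thesis
        using norm_triangle_ineq[of "X n - X (r ?k)" "X (r ?k) - L"] by simp
    qed
    then show "\<exists>no. \<forall>n\<ge>no. norm (X n - L) < e" by blast
  qed
  then show "convergent X" by (rule convergentI)
qed


section \<open>The Hartley-Fourier generalized convolution\<close>

definition hf_conv_fun :: "(real \<Rightarrow> complex) \<Rightarrow> (real \<Rightarrow> complex) \<Rightarrow> real \<Rightarrow> complex" where
  "hf_conv_fun f g x = complex_of_real (1 / (2 * sqrt (2 * pi))) *
     (\<integral>y. g y * (f (x + y) + f (x - y) + \<i> * f (- x - y) - \<i> * f (- x + y)) \<partial>lborel)"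

lemma integrable_conv_kernel:
  fixes f g :: "real \<Rightarrow> complex"
  assumes f: "integrable lborel f" and g: "integrable lborel g" and s: "s \<noteq> 0"
  shows "integrable (lborel \<Otimes>\<^sub>M lborel) (\<lambda>(y, x). g y * f (t * y + s * x))"
proof (rule lborel_pair.Fubini_integrable)
  have [measurable]: "f \<in> borel_measurable borel" "g \<in> borel_measurable borel"
    using f g by auto
  show "(\<lambda>(y, x). g y * f (t * y + s * x)) \<in> borel_measurable (lborel \<Otimes>\<^sub>M lborel)"
    by measurable
  have "(\<integral>x. norm (f (t * y + s * x)) \<partial>lborel) = (\<integral>x. norm (f x) \<partial>lborel) / \<bar>s\<bar>" for y
    using lborel_integral_real_affine[OF s, of "\<lambda>x. norm (f x)" "t * y"] s
    by (simp add: field_simps)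
  then show "integrable lborel
      (\<lambda>y. \<integral>x. norm (case (y, x) of (y, x) \<Rightarrow> g y * f (t * y + s * x)) \<partial>lborel)"
    using g by (simp add: norm_mult)
  show "AE y in lborel. integrable lborel (\<lambda>x. case (y, x) of (y, x) \<Rightarrow> g y * f (t * y + s * x))"
    using lborel_integrable_real_affine[OF f s] by simp
qed

lemma integrable_hf_conv_fun:
  assumes f: "integrable lborel f" and g: "integrable lborel g"
  shows "integrable lborel (hf_conv_fun f g)"
proof -
  have "integrable (lborel \<Otimes>\<^sub>M lborel) (\<lambda>p.
      (case p of (y, x) \<Rightarrow> g y * f (1 * y + 1 * x)) + (case p of (y, x) \<Rightarrow> g y * f ((-1) * y + 1 * x))
      + \<i> * (case p of (y, x) \<Rightarrow> g y * f ((-1) * y + (-1) * x))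
      - \<i> * (case p of (y, x) \<Rightarrow> g y * f (1 * y + (-1) * x)))"
    by (intro Bochner_Integration.integrable_add Bochner_Integration.integrable_diff
        integrable_mult_right integrable_conv_kernel f g) auto
  also have "(\<lambda>p.
      (case p of (y, x) \<Rightarrow> g y * f (1 * y + 1 * x)) + (case p of (y, x) \<Rightarrow> g y * f ((-1) * y + 1 * x))
      + \<i> * (case p of (y, x) \<Rightarrow> g y * f ((-1) * y + (-1) * x))
      - \<i> * (case p of (y, x) \<Rightarrow> g y * f (1 * y + (-1) * x))) =
    (\<lambda>(y, x). g y * (f (x + y) + f (x - y) + \<i> * f (- x - y) - \<i> * f (- x + y)))"
    by (auto simp: fun_eq_iff algebra_simps minus_diff_commute)
  finally have "integrable lborel
      (\<lambda>x. \<integral>y. g y * (f (x + y) + f (x - y) + \<i> * f (- x - y) - \<i> * f (- x + y)) \<partial>lborel)"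
    by (rule lborel_pair.integrable_snd)
  then show ?thesis
    unfolding hf_conv_fun_def by (rule integrable_mult_right)
qed

lemma hf_conv_fun_cong_AE:
  assumes "L1_rel f f'" "L1_rel g g'"
  shows "hf_conv_fun f g x = hf_conv_fun f' g' x"
proof -
  have [measurable]: "f \<in> borel_measurable borel" "f' \<in> borel_measurable borel"
      "g \<in> borel_measurable borel" "g' \<in> borel_measurable borel"
    using assms by (auto simp: L1_rel_def)
  have eqs: "AE y in lborel. g y = g' y" "AE y in lborel. f y = f' y"
    using assms by (auto simp: L1_rel_def)
  have aff: "AE y in lborel. f (t + c * y) = f' (t + c * y)" if "c \<noteq> 0" for t c
    using that eqs(2) by (intro AE_borel_affine[where P = "\<lambda>y. f y = f' y"]) auto
  have "AE y in lborel. g y * (f (x + y) + f (x - y) + \<i> * f (- x - y) - \<i> * f (- x + y)) =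
      g' y * (f' (x + y) + f' (x - y) + \<i> * f' (- x - y) - \<i> * f' (- x + y))"
    using eqs(1) aff[of 1 x, simplified] aff[of "-1" x, simplified]
      aff[of "-1" "-x", simplified] aff[of 1 "-x", simplified]
    by eventually_elim simp
  then have "(\<integral>y. g y * (f (x + y) + f (x - y) + \<i> * f (- x - y) - \<i> * f (- x + y)) \<partial>lborel) =
      (\<integral>y. g' y * (f' (x + y) + f' (x - y) + \<i> * f' (- x - y) - \<i> * f' (- x + y)) \<partial>lborel)"
    by (intro integral_cong_AE) auto
  then show ?thesis by (simp add: hf_conv_fun_def)
qed

lift_definition hf_conv :: "L1 \<Rightarrow> L1 \<Rightarrow> L1" (infixl "\<circledast>" 70) is hf_conv_fun
proof -
  fix f f' g g' :: "real \<Rightarrow> complex"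
  assume rel: "L1_rel f f'" "L1_rel g g'"
  then show "L1_rel (hf_conv_fun f g) (hf_conv_fun f' g')"
    using hf_conv_fun_cong_AE[OF rel]
    by (auto simp: L1_rel_def intro!: integrable_hf_conv_fun)
qed


section \<open>Normed rings\<close>

definition is_unit_element :: "('v \<Rightarrow> 'v \<Rightarrow> 'v) \<Rightarrow> 'v \<Rightarrow> bool" where
  "is_unit_element mul u \<longleftrightarrow> (\<forall>v. mul u v = v \<and> mul v u = v)"

text \<open>
  A complex vector space with a vector norm and a ring structure, the multiplication being
  compatible with the scalars. Associativity is deliberately not among the ring axioms: the
  Hartley-Fourier convolution is not associative. Indeed, writing \<open>\<star>\<close> for the ordinary convolution,
  \<open>f \<circledast> g = (2 * pi) powr (-1/2) f \<star> g\<close> for even \<open>g\<close>, and for odd \<open>g\<close> it is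
  \<open>-\<i> (2 * pi) powr (-1/2) f \<star> g\<close> if \<open>f\<close> is even and \<open>\<i> (2 * pi) powr (-1/2) f \<star> g\<close> if \<open>f\<close> is odd;
  hence \<open>f \<circledast> (g \<circledast> h) = \<i> ((f \<circledast> g) \<circledast> h)\<close> for even \<open>f\<close> and odd \<open>g\<close>, \<open>h\<close>.
\<close>

locale normed_ring = vector_space scale
  for scale :: "complex \<Rightarrow> 'v::ab_group_add \<Rightarrow> 'v"
    and vnorm :: "'v \<Rightarrow> real"
    and mul :: "'v \<Rightarrow> 'v \<Rightarrow> 'v" +
  assumes vnorm_eq_0_iff: "vnorm v = 0 \<longleftrightarrow> v = 0"
    and vnorm_triangle: "vnorm (v + w) \<le> vnorm v + vnorm w"
    and vnorm_scale: "vnorm (scale c v) = cmod c * vnorm v"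
    and mult_distrib_left: "mul v (w + z) = mul v w + mul v z"
    and mult_distrib_right: "mul (v + w) z = mul v z + mul w z"
    and mult_scale_left: "mul (scale c v) w = scale c (mul v w)"
    and mult_scale_right: "mul v (scale c w) = scale c (mul v w)"
    and vnorm_mult_le: "vnorm (mul v w) \<le> vnorm v * vnorm w"
    and vnorm_unit: "is_unit_element mul u \<Longrightarrow> vnorm u = 1"

end

theory Submission
  imports Defs
begin

text \<open>
  Up to a constant, \<open>f \<circledast> g\<close> integrates \<open>g(y)\<close> against a kernel \<open>K f x y\<close> that combines four
  reflected translates of \<open>f\<close>. By Tonelli's theorem \<open>(y, x) \<mapsto> g(y) K f x y\<close> is integrable on the
  plane, hence for almost every \<open>x\<close> the integral over \<open>y\<close> exists. This makes the product bilinear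
  on classes of functions. Integrating over \<open>x\<close> first shows that its norm is at most
  \<open>4 / (2 sqrt (2 pi)) = sqrt (2 / pi)\<close> times the product of the norms, and \<open>sqrt (2 / pi) < 1\<close>.

  The product is not commutative because its two arguments are reflected differently. For real
  functions the real part of \<open>(f \<circledast> g)(x)\<close> integrates \<open>g(y) (f(x + y) + f(x - y))\<close>. If \<open>f\<close> lives
  far to the right and \<open>g\<close> close to the origin, this vanishes for every negative \<open>x\<close>, whereas the
  real part of \<open>g \<circledast> f\<close> is also carried by the mirror image of the support of \<open>f\<close>.

  There is not even a right unit \<open>U\<close>, because such a \<open>U\<close> would have to be a point mass at the origin.
  For the indicator \<open>f\<close> of \<open>[-e, e]\<close> and \<open>x\<close> in \<open>[-e, e]\<close>, only the values of \<open>U\<close> on \<open>[-2e, 2e]\<close>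
  contribute to \<open>(f \<circledast> U)(x)\<close>, so this number tends to \<open>0\<close> with \<open>e\<close>, although it would have to be
  \<open>f(x) = 1\<close>. In particular, the normalization of a unit element required of a normed ring holds
  vacuously.
\<close>


section \<open>The kernel of the convolution\<close>

definition hf_kernel :: "(real \<Rightarrow> complex) \<Rightarrow> real \<Rightarrow> real \<Rightarrow> complex" where
  "hf_kernel f x y = f (x + y) + f (x - y) + \<i> * f (- x - y) - \<i> * f (- x + y)"

lemma hf_conv_fun_kernel:
  "hf_conv_fun f g x =
    complex_of_real (1 / (2 * sqrt (2 * pi))) * (\<integral>y. g y * hf_kernel f x y \<partial>lborel)"
  by (simp add: hf_conv_fun_def hf_kernel_def)

lemma norm_hf_kernel_le:
  "norm (hf_kernel f x y) \<le>
    norm (f (x + y)) + norm (f (x - y)) + norm (f (- x - y)) + norm (f (- x + y))"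
  unfolding hf_kernel_def
  by (intro order_trans[OF norm_triangle_ineq4] order_trans[OF norm_triangle_ineq] add_mono)
    (auto simp: norm_mult)

lemma hf_kernel_add: "hf_kernel (\<lambda>x. f x + g x) x y = hf_kernel f x y + hf_kernel g x y"
  by (simp add: hf_kernel_def algebra_simps)

lemma hf_kernel_scale: "hf_kernel (\<lambda>x. c * f x) x y = c * hf_kernel f x y"
  by (simp add: hf_kernel_def algebra_simps)

lemma
  fixes f :: "real \<Rightarrow> complex"
  assumes f: "integrable lborel f"
  shows integrable_hf_kernel: "integrable lborel (\<lambda>x. hf_kernel f x y)"
    and integral_norm_hf_kernel_le:
      "(\<integral>x. norm (hf_kernel f x y) \<partial>lborel) \<le> 4 * (\<integral>x. norm (f x) \<partial>lborel)"
proof -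
  have i: "integrable lborel (\<lambda>x. f (t + c * x))" if "c \<noteq> 0" for c t
    using lborel_integrable_real_affine[OF f that] .
  have n: "(\<integral>x. norm (f (t + c * x)) \<partial>lborel) = (\<integral>x. norm (f x) \<partial>lborel)" if "\<bar>c\<bar> = 1" for c t
    using lborel_integral_real_affine[of c "\<lambda>x. norm (f x)" t] that by fastforce
  have i4: "integrable lborel (\<lambda>x. f (x + y))" "integrable lborel (\<lambda>x. f (x - y))"
    "integrable lborel (\<lambda>x. f (- x - y))" "integrable lborel (\<lambda>x. f (- x + y))"
    using i[of 1 y] i[of 1 "-y"] i[of "-1" "-y"] i[of "-1" y]
    by (simp_all add: algebra_simps minus_diff_commute)
  have n4: "(\<integral>x. norm (f (x + y)) \<partial>lborel) = (\<integral>x. norm (f x) \<partial>lborel)"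
    "(\<integral>x. norm (f (x - y)) \<partial>lborel) = (\<integral>x. norm (f x) \<partial>lborel)"
    "(\<integral>x. norm (f (- x - y)) \<partial>lborel) = (\<integral>x. norm (f x) \<partial>lborel)"
    "(\<integral>x. norm (f (- x + y)) \<partial>lborel) = (\<integral>x. norm (f x) \<partial>lborel)"
    using n[of 1 y] n[of 1 "-y"] n[of "-1" "-y"] n[of "-1" y]
    by (simp_all add: algebra_simps minus_diff_commute)
  show K: "integrable lborel (\<lambda>x. hf_kernel f x y)"
    unfolding hf_kernel_def using i4 by auto
  have "(\<integral>x. norm (hf_kernel f x y) \<partial>lborel) \<le>
      (\<integral>x. norm (f (x + y)) + norm (f (x - y)) + norm (f (- x - y)) + norm (f (- x + y)) \<partial>lborel)"
    using K i4 by (intro integral_mono norm_hf_kernel_le) auto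
  also have "\<dots> = 4 * (\<integral>x. norm (f x) \<partial>lborel)"
    using i4 n4 by simp
  finally show "(\<integral>x. norm (hf_kernel f x y) \<partial>lborel) \<le> 4 * (\<integral>x. norm (f x) \<partial>lborel)" .
qed

text \<open>
  Everything about the product that concerns more than one point \<open>x\<close> rests on Fubini's theorem for
  this function of two variables. The order of the variables is chosen such that the inner
  integral over \<open>x\<close> only involves the kernel.
\<close>

lemma integrable_hf_kernel_pair:
  fixes f g :: "real \<Rightarrow> complex"
  assumes f: "integrable lborel f" and g: "integrable lborel g"
  shows "integrable (lborel \<Otimes>\<^sub>M lborel) (\<lambda>(y, x). g y * hf_kernel f x y)"
proof (rule lborel_pair.Fubini_integrable)
  have [measurable]: "f \<in> borel_measurable borel" "g \<in> borel_measurable borel"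
    using f g by auto
  show meas: "(\<lambda>(y, x). g y * hf_kernel f x y) \<in> borel_measurable (lborel \<Otimes>\<^sub>M lborel)"
    unfolding hf_kernel_def by measurable
  have [measurable]: "(\<lambda>(y, x). hf_kernel f x y) \<in> borel_measurable (lborel \<Otimes>\<^sub>M lborel)"
    unfolding hf_kernel_def by measurable
  have m: "(\<lambda>y. \<integral>x. norm (hf_kernel f x y) \<partial>lborel) \<in> borel_measurable lborel"
    by measurable
  have "integrable lborel (\<lambda>y. norm (g y) * (\<integral>x. norm (hf_kernel f x y) \<partial>lborel))"
  proof (rule Bochner_Integration.integrable_bound)
    show "integrable lborel (\<lambda>y. norm (g y) * (4 * (\<integral>x. norm (f x) \<partial>lborel)))"
      using g by simp
    show "AE y in lborel. norm (norm (g y) * (\<integral>x. norm (hf_kernel f x y) \<partial>lborel)) \<le>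
        norm (norm (g y) * (4 * (\<integral>x. norm (f x) \<partial>lborel)))"
      using integral_norm_hf_kernel_le[OF f]
      by (auto simp: abs_mult intro!: mult_left_mono)
  qed (use m in measurable)
  then show "integrable lborel
      (\<lambda>y. \<integral>x. norm (case (y, x) of (y, x) \<Rightarrow> g y * hf_kernel f x y) \<partial>lborel)"
    by (simp add: norm_mult)
  show "AE y in lborel. integrable lborel (\<lambda>x. case (y, x) of (y, x) \<Rightarrow> g y * hf_kernel f x y)"
    using integrable_hf_kernel[OF f] by simp
qed

lemma AE_integrable_hf_kernel:
  assumes "integrable lborel f" "integrable lborel g"
  shows "AE x in lborel. integrable lborel (\<lambda>y. g y * hf_kernel f x y)"
  using lborel_pair.AE_integrable_snd[OF integrable_hf_kernel_pair[OF assms]] by simp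


section \<open>Bilinearity and submultiplicativity\<close>

lemma hf_conv_fun_add_right:
  assumes "integrable lborel f" "integrable lborel g" "integrable lborel h"
  shows "AE x in lborel.
    hf_conv_fun f (\<lambda>x. g x + h x) x = hf_conv_fun f g x + hf_conv_fun f h x"
  using AE_integrable_hf_kernel[OF assms(1,2)] AE_integrable_hf_kernel[OF assms(1,3)]
  by eventually_elim (simp add: hf_conv_fun_kernel distrib_left distrib_right)

lemma hf_conv_fun_add_left:
  assumes "integrable lborel f" "integrable lborel g" "integrable lborel h"
  shows "AE x in lborel.
    hf_conv_fun (\<lambda>x. f x + g x) h x = hf_conv_fun f h x + hf_conv_fun g h x"
  using AE_integrable_hf_kernel[OF assms(1,3)] AE_integrable_hf_kernel[OF assms(2,3)]
  by eventually_elim (simp add: hf_conv_fun_kernel hf_kernel_add distrib_left)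

lemma hf_conv_fun_scale_left: "hf_conv_fun (\<lambda>x. c * f x) g x = c * hf_conv_fun f g x"
  by (simp add: hf_conv_fun_kernel hf_kernel_scale mult.left_commute[of _ c])

lemma hf_conv_fun_scale_right: "hf_conv_fun f (\<lambda>x. c * g x) x = c * hf_conv_fun f g x"
  by (simp add: hf_conv_fun_kernel mult.assoc mult.left_commute[of _ c])

lemma hf_const_le: "4 * (1 / (2 * sqrt (2 * pi))) \<le> 1"
proof -
  have "sqrt 4 \<le> sqrt (2 * pi)"
    using pi_gt3 by (intro real_sqrt_le_mono) simp
  then show ?thesis by (simp add: field_simps)
qed

text \<open>
  After moving the norm inside, Fubini's theorem lets one integrate the kernel over \<open>x\<close> first; by
  translation and reflection invariance each of its four terms contributes at most the norm of \<open>f\<close>.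
\<close>

lemma integral_norm_hf_conv_fun_le:
  fixes f g :: "real \<Rightarrow> complex"
  assumes f: "integrable lborel f" and g: "integrable lborel g"
  shows "(\<integral>x. norm (hf_conv_fun f g x) \<partial>lborel) \<le>
    (\<integral>x. norm (f x) \<partial>lborel) * (\<integral>x. norm (g x) \<partial>lborel)"
proof -
  define c where "c = 1 / (2 * sqrt (2 * pi))"
  have c: "0 \<le> c" "4 * c \<le> 1"
    using hf_const_le by (simp_all add: c_def)
  have int2: "integrable (lborel \<Otimes>\<^sub>M lborel) (\<lambda>(y, x). norm (g y * hf_kernel f x y))"
    using integrable_norm[OF integrable_hf_kernel_pair[OF f g]] by (simp add: split_beta')
  have "(\<integral>x. norm (hf_conv_fun f g x) \<partial>lborel) \<le>
      (\<integral>x. c * (\<integral>y. norm (g y * hf_kernel f x y) \<partial>lborel) \<partial>lborel)"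
  proof (rule integral_mono)
    show "integrable lborel (\<lambda>x. norm (hf_conv_fun f g x))"
      using integrable_hf_conv_fun[OF f g] by simp
    show "integrable lborel (\<lambda>x. c * (\<integral>y. norm (g y * hf_kernel f x y) \<partial>lborel))"
      using lborel_pair.integrable_snd[OF int2] by simp
    show "norm (hf_conv_fun f g x) \<le> c * (\<integral>y. norm (g y * hf_kernel f x y) \<partial>lborel)" for x
      using c(1) unfolding hf_conv_fun_kernel c_def[symmetric] norm_mult norm_of_real
      by (simp add: mult_left_mono flip: norm_mult)
  qed
  also have "\<dots> = c * (\<integral>x. (\<integral>y. norm (g y * hf_kernel f x y) \<partial>lborel) \<partial>lborel)"
    by simp
  also have "(\<integral>x. (\<integral>y. norm (g y * hf_kernel f x y) \<partial>lborel) \<partial>lborel) =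
      (\<integral>y. (\<integral>x. norm (g y * hf_kernel f x y) \<partial>lborel) \<partial>lborel)"
    using lborel_pair.Fubini_integral[OF int2] .
  also have "\<dots> \<le> (\<integral>y. norm (g y) * (4 * (\<integral>x. norm (f x) \<partial>lborel)) \<partial>lborel)"
  proof (rule integral_mono)
    show "integrable lborel (\<lambda>y. \<integral>x. norm (g y * hf_kernel f x y) \<partial>lborel)"
      using lborel_pair.integrable_fst[OF int2] .
    show "integrable lborel (\<lambda>y. norm (g y) * (4 * (\<integral>x. norm (f x) \<partial>lborel)))"
      using g by simp
    show "(\<integral>x. norm (g y * hf_kernel f x y) \<partial>lborel) \<le>
        norm (g y) * (4 * (\<integral>x. norm (f x) \<partial>lborel))" for y
      using integral_norm_hf_kernel_le[OF f, of y] by (simp add: norm_mult mult_left_mono)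
  qed
  also have "c * \<dots> = 4 * c * ((\<integral>x. norm (f x) \<partial>lborel) * (\<integral>x. norm (g x) \<partial>lborel))"
    by simp
  also have "\<dots> \<le> (\<integral>x. norm (f x) \<partial>lborel) * (\<integral>x. norm (g x) \<partial>lborel)"
    using c by (intro mult_left_le_one_le) auto
  finally show ?thesis
    using c(1) by (simp add: mult_left_mono)
qed


section \<open>Failure of commutativity\<close>

text \<open>Identities of classes hold only almost everywhere; this turns them into pointwise ones.\<close>

lemma AE_lborel_interval_exists:
  fixes a b :: real
  assumes "AE x in lborel. P x" "a < b"
  shows "\<exists>x\<in>{a<..<b}. P x"
proof (rule ccontr)
  assume "\<not> ?thesis"
  with assms(1) have "AE x in lborel. x \<notin> {a<..<b}"
    by (auto elim: eventually_mono)
  then have "emeasure lborel {a<..<b} = 0"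
    by (subst (asm) AE_iff_null_sets[symmetric]) auto
  with assms(2) show False by simp
qed

lemma integrable_indicator_interval [simp]:
  fixes a b :: real
  shows "integrable lborel (indicator {a..b} :: real \<Rightarrow> complex)"
proof -
  have "integrable lborel (\<lambda>x. indicator {a..b} x *\<^sub>R (1 :: complex))"
    by (rule integrableI_bounded_set_indicator[of _ _ _ 1]) (auto simp: emeasure_lborel_Icc_eq)
  also have "(\<lambda>x. indicator {a..b} x *\<^sub>R (1 :: complex)) = indicator {a..b}"
    by (auto simp: indicator_def)
  finally show ?thesis .
qed

text \<open>
  The indicators of \<open>[3, 4]\<close> and \<open>[0, 1]\<close> are told apart by the real parts of their products on
  \<open>(-4, -3)\<close>. There \<open>x + y\<close> and \<open>x - y\<close> are negative for all \<open>y\<close> in \<open>[0, 1]\<close>, whereas \<open>x + y\<close>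
  returns to \<open>[0, 1]\<close> for \<open>y\<close> in \<open>[-x, 4]\<close>.
\<close>

lemma hf_conv_fun_not_commutative:
  defines "f \<equiv> indicator {3..4} :: real \<Rightarrow> complex"
    and "g \<equiv> indicator {0..1} :: real \<Rightarrow> complex"
  shows "\<not> (AE x in lborel. hf_conv_fun f g x = hf_conv_fun g f x)"
proof
  assume "AE x in lborel. hf_conv_fun f g x = hf_conv_fun g f x"
  moreover have "AE x in lborel. integrable lborel (\<lambda>y. f y * hf_kernel g x y)"
    "AE x in lborel. integrable lborel (\<lambda>y. g y * hf_kernel f x y)"
    by (intro AE_integrable_hf_kernel; simp add: f_def g_def)+
  ultimately have "AE x in lborel. hf_conv_fun f g x = hf_conv_fun g f x \<and>
      integrable lborel (\<lambda>y. f y * hf_kernel g x y) \<and>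
      integrable lborel (\<lambda>y. g y * hf_kernel f x y)"
    by eventually_elim simp
  from AE_lborel_interval_exists[OF this, of "-4" "-3"]
  obtain x where x: "-4 < x" "x < -3" and eq: "hf_conv_fun f g x = hf_conv_fun g f x"
    and i: "integrable lborel (\<lambda>y. f y * hf_kernel g x y)"
      "integrable lborel (\<lambda>y. g y * hf_kernel f x y)"
    by auto
  have "(\<integral>y. g y * hf_kernel f x y \<partial>lborel) = (\<integral>y. f y * hf_kernel g x y \<partial>lborel)"
    using eq by (simp add: hf_conv_fun_kernel)
  then have "(\<integral>y. Re (g y * hf_kernel f x y) \<partial>lborel) = (\<integral>y. Re (f y * hf_kernel g x y) \<partial>lborel)"
    by (simp only: integral_Re[OF i(1)] integral_Re[OF i(2)])
  moreover have "Re (g y * hf_kernel f x y) = 0" for y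
    using x by (auto simp: f_def g_def hf_kernel_def indicator_def)
  moreover have "Re (f y * hf_kernel g x y) = indicator {-x..4} y" for y
    using x by (auto simp: f_def g_def hf_kernel_def indicator_def)
  ultimately show False
    using x by simp
qed


section \<open>Absence of a unit element\<close>

lemma integral_norm_shrinking_interval:
  fixes u :: "real \<Rightarrow> complex"
  assumes u: "integrable lborel u"
  shows "(\<lambda>n. \<integral>y. indicator {- (2 / Suc n)..2 / Suc n} y * norm (u y) \<partial>lborel) \<longlonglongrightarrow> 0"
proof -
  have [measurable]: "u \<in> borel_measurable borel"
    using u by auto
  have "(\<lambda>n. \<integral>y. indicator {- (2 / Suc n)..2 / Suc n} y * norm (u y) \<partial>lborel) \<longlonglongrightarrow>
      (\<integral>y. 0 \<partial>(lborel :: real measure))"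
  proof (rule integral_dominated_convergence)
    show "integrable lborel (\<lambda>y. norm (u y))"
      using u by simp
    show "AE y in lborel. (\<lambda>n. indicator {- (2 / Suc n)..2 / Suc n} y * norm (u y)) \<longlonglongrightarrow> 0"
      using AE_lborel_singleton[of 0]
    proof eventually_elim
      case (elim y)
      have "(\<lambda>n. 2 / real (Suc n)) \<longlonglongrightarrow> 0"
        by (rule LIMSEQ_Suc[OF lim_const_over_n])
      then have "\<forall>\<^sub>F n in sequentially. 2 / real (Suc n) < \<bar>y\<bar>"
        by (rule order_tendstoD) (use elim in simp)
      then have "\<forall>\<^sub>F n in sequentially.
          indicator {- (2 / real (Suc n))..2 / real (Suc n)} y * norm (u y) = 0"
        by eventually_elim (auto simp: indicator_def)
      then show ?case by (rule tendsto_eventually)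
    qed
  qed (auto simp: indicator_def)
  then show ?thesis by simp
qed

text \<open>
  The arguments of all four terms of the kernel are \<open>x + y\<close> or \<open>x - y\<close> up to sign, so near the origin
  the product with the indicator of \<open>[-e, e]\<close> only sees the part of \<open>u\<close> on \<open>[-2e, 2e]\<close>.
\<close>

lemma norm_hf_conv_fun_indicator_le:
  fixes u :: "real \<Rightarrow> complex"
  assumes u: "integrable lborel u" and x: "\<bar>x\<bar> \<le> e"
  shows "norm (hf_conv_fun (indicator {-e..e}) u x) \<le>
    (\<integral>y. indicator {- (2 * e)..2 * e} y * norm (u y) \<partial>lborel)"
proof -
  define f :: "real \<Rightarrow> complex" where "f = indicator {-e..e}"
  define c where "c = 1 / (2 * sqrt (2 * pi))"
  have c: "0 \<le> c" "4 * c \<le> 1"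
    using hf_const_le by (simp_all add: c_def)
  have [measurable]: "u \<in> borel_measurable borel"
    using u by auto
  have bound: "norm (u y * hf_kernel f x y) \<le> 4 * (indicator {- (2 * e)..2 * e} y * norm (u y))"
    for y
  proof (cases "y \<in> {- (2 * e)..2 * e}")
    case True
    have "norm (f t) \<le> 1" for t
      by (simp add: f_def indicator_def)
    then have "norm (hf_kernel f x y) \<le> 1 + 1 + 1 + 1"
      by (intro order_trans[OF norm_hf_kernel_le] add_mono)
    with True show ?thesis
      using mult_right_mono[of "norm (hf_kernel f x y)" 4 "norm (u y)"]
      by (simp add: norm_mult mult.commute)
  next
    case False
    with x have "hf_kernel f x y = 0"
      by (auto simp: hf_kernel_def f_def indicator_def)
    then show ?thesis by simp
  qed
  have int: "integrable lborel (\<lambda>y. indicator {- (2 * e)..2 * e} y * norm (u y))"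
    using integrable_mult_indicator[of "{- (2 * e)..2 * e}" lborel "\<lambda>y. norm (u y)"] u by simp
  have "norm (\<integral>y. u y * hf_kernel f x y \<partial>lborel) \<le>
      (\<integral>y. 4 * (indicator {- (2 * e)..2 * e} y * norm (u y)) \<partial>lborel)"
  proof (rule Bochner_Integration.integral_norm_bound_integral)
    show int4: "integrable lborel (\<lambda>y. 4 * (indicator {- (2 * e)..2 * e} y * norm (u y)))"
      using int by simp
    have "(\<lambda>y. u y * hf_kernel f x y) \<in> borel_measurable lborel"
      unfolding hf_kernel_def f_def by measurable
    with int4 show "integrable lborel (\<lambda>y. u y * hf_kernel f x y)"
      by (rule Bochner_Integration.integrable_bound)
        (use bound in \<open>auto intro: order_trans[OF _ abs_ge_self]\<close>)
  qed (rule bound)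
  then have "norm (hf_conv_fun f u x) \<le>
      c * (4 * (\<integral>y. indicator {- (2 * e)..2 * e} y * norm (u y) \<partial>lborel))"
    using c(1) unfolding hf_conv_fun_kernel c_def[symmetric] norm_mult norm_of_real
    by (simp add: mult_left_mono)
  also have "\<dots> = 4 * c * (\<integral>y. indicator {- (2 * e)..2 * e} y * norm (u y) \<partial>lborel)"
    by simp
  also have "\<dots> \<le> (\<integral>y. indicator {- (2 * e)..2 * e} y * norm (u y) \<partial>lborel)"
    using c by (intro mult_left_le_one_le) (auto intro!: integral_nonneg_AE)
  finally show ?thesis by (simp add: f_def)
qed

lemma hf_conv_fun_no_right_unit:
  fixes u :: "real \<Rightarrow> complex"
  assumes u: "integrable lborel u"
  shows "\<exists>f. integrable lborel f \<and> \<not> (AE x in lborel. hf_conv_fun f u x = f x)"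
proof -
  have "\<forall>\<^sub>F n in sequentially.
      (\<integral>y. indicator {- (2 / Suc n)..2 / Suc n} y * norm (u y) \<partial>lborel) < 1"
    using integral_norm_shrinking_interval[OF u] by (rule order_tendstoD) simp
  then obtain n where
    n: "(\<integral>y. indicator {- (2 / Suc n)..2 / Suc n} y * norm (u y) \<partial>lborel) < 1"
    using eventually_happens by fastforce
  define e where "e = 1 / real (Suc n)"
  define f :: "real \<Rightarrow> complex" where "f = indicator {-e..e}"
  have e: "0 < e" by (simp add: e_def)
  have "\<not> (AE x in lborel. hf_conv_fun f u x = f x)"
  proof
    assume "AE x in lborel. hf_conv_fun f u x = f x"
    from AE_lborel_interval_exists[OF this, of "-e" e] e
    obtain x where x: "-e < x" "x < e" "hf_conv_fun f u x = f x"
      by auto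
    then have "1 = norm (hf_conv_fun f u x)"
      by (simp add: f_def)
    also have "\<dots> < 1"
    proof (rule le_less_trans)
      show "norm (hf_conv_fun f u x) \<le>
          (\<integral>y. indicator {- (2 * e)..2 * e} y * norm (u y) \<partial>lborel)"
        unfolding f_def using x(1,2) by (intro norm_hf_conv_fun_indicator_le u) auto
      show "(\<integral>y. indicator {- (2 * e)..2 * e} y * norm (u y) \<partial>lborel) < 1"
        using n by (simp add: e_def)
    qed
    finally show False by simp
  qed
  then show ?thesis
    by (intro exI[of _ f]) (simp add: f_def)
qed


section \<open>Transfer to classes of functions\<close>

lemma hf_conv_not_commutative: "\<exists>f g :: L1. f \<circledast> g \<noteq> g \<circledast> f"
proof -
  define f g :: "real \<Rightarrow> complex" where "f = indicator {3..4}" and "g = indicator {0..1}"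
  have fg: "L1_rel f f" "L1_rel g g"
    by (simp_all add: L1_rel_def f_def g_def)
  have "\<not> L1_rel (hf_conv_fun f g) (hf_conv_fun g f)"
    using hf_conv_fun_not_commutative by (simp add: L1_rel_def f_def g_def)
  with fg have "abs_L1 f \<circledast> abs_L1 g \<noteq> abs_L1 g \<circledast> abs_L1 f"
    using Quotient_rel[OF Quotient_L1, of "hf_conv_fun f g" "hf_conv_fun g f"]
    by (simp add: hf_conv.abs_eq L1_rel_def integrable_hf_conv_fun)
  then show ?thesis by blast
qed

lemma hf_conv_no_right_unit: "\<exists>f :: L1. f \<circledast> U \<noteq> f"
proof (transfer, goal_cases)
  case (1 U)
  then show ?case
    using hf_conv_fun_no_right_unit[of U]
    by (auto simp: L1_rel_def)
qed

lemma no_unit_element: "\<not> is_unit_element (\<circledast>) (U :: L1)"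
  using hf_conv_no_right_unit[of U] by (auto simp: is_unit_element_def)

lemma normed_ring_L1: "normed_ring scale_L1 norm (\<circledast>)"
proof
  fix a b c :: complex and v w z u :: L1
  show "scale_L1 a (v + w) = scale_L1 a v + scale_L1 a w"
    by transfer (auto simp: L1_rel_def distrib_left)
  show "scale_L1 (a + b) v = scale_L1 a v + scale_L1 b v"
    by transfer (auto simp: L1_rel_def distrib_right)
  show "scale_L1 a (scale_L1 b v) = scale_L1 (a * b) v"
    by transfer (auto simp: L1_rel_def mult.assoc)
  show "scale_L1 1 v = v"
    by transfer (auto simp: L1_rel_def)
  show "norm v = 0 \<longleftrightarrow> v = 0"
    by simp
  show "norm (v + w) \<le> norm v + norm w"
    by (rule norm_triangle_ineq)
  show "norm (scale_L1 c v) = cmod c * norm v"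
    by transfer (auto simp: norm_mult)
  show "v \<circledast> (w + z) = v \<circledast> w + v \<circledast> z"
    by transfer (auto simp: L1_rel_def integrable_hf_conv_fun hf_conv_fun_add_right)
  show "(v + w) \<circledast> z = v \<circledast> z + w \<circledast> z"
    by transfer (auto simp: L1_rel_def integrable_hf_conv_fun hf_conv_fun_add_left)
  show "scale_L1 c v \<circledast> w = scale_L1 c (v \<circledast> w)"
    by transfer (auto simp: L1_rel_def integrable_hf_conv_fun hf_conv_fun_scale_left)
  show "v \<circledast> scale_L1 c w = scale_L1 c (v \<circledast> w)"
    by transfer (auto simp: L1_rel_def integrable_hf_conv_fun hf_conv_fun_scale_right)
  show "norm (v \<circledast> w) \<le> norm v * norm w"
    by transfer (auto simp: L1_rel_def integral_norm_hf_conv_fun_le)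
  show "norm u = 1" if "is_unit_element (\<circledast>) u"
    using that no_unit_element by blast
qed

theorem theorem4p1:
  shows "normed_ring scale_L1 norm (\<circledast>) \<and>
    \<not> (\<forall>f g :: L1. f \<circledast> g = g \<circledast> f) \<and>
    \<not> (\<exists>U :: L1. is_unit_element (\<circledast>) U)"
  using normed_ring_L1 hf_conv_not_commutative no_unit_element by blast

end
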